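(* Let $q$ be a power of an odd prime $p$. Let $f(x)$ and $g(y)$ be nonconstant polynomials defined over $\mathbb{F}_q$ such that $f(x)-g(y)\notin \mathbb{F}_q[x^p,y^p]$. Suppose that the irreducible components of the curve $\mathcal{F}: f(x)=g(y)$ are defined over $\mathbb{F}_q$, and that $f(x)$ and $g(y)$ are minimal value set polynomials over $\mathbb{F}_q$ with $V_f=V_g=\{0,1\}$. Then the irreducible components of $\mathcal{F}$ are $q$-Frobenius nonclassical if and only if $f$ and $g$ are both of type $A$ or both of type $B$.
   Context: $\overline{\mathbb{F}_q}$ is the algebraic closure of $\mathbb{F}_q$. For a nonconstant $F\in\mathbb{F}_q[x]$, $V_F=\{F(\alpha):\alpha\in\mathbb{F}_q\}$ is its value set; $F$ is called a minimal value set polynomial if $|V_F|=\lfloor (q-1)/\deg F\rfloor+1$. Define the following subsets of $\mathbb{F}_q[t]$: $$\mathcal{A}=\Big\{\tfrac{g'}{g}(t-t^{q}) : g\in\mathbb{F}_q[t] \text{ is a monic proper divisor of } t^q-t \text{ and } g''=0\Big\},\qquad \mathcal{B}=\{1-f: f\in\mathcal{A}\},$$ where $g',g''$ are formal derivatives. A polynomial $f$ is of type $A$ if $f(t)\in\mathcal{A}$, and of type $B$ if $f(t)\in\mathcal{B}$. The irreducible components of a plane curve $G(x,y)=0$ are the curves $G_i=0$, where the $G_i$ are the irreducible factors of $G$ in $\overline{\mathbb{F}_q}[x,y]$; a component is defined over $\mathbb{F}_q$ if, up to a nonzero constant, $G_i\in\mathbb{F}_q[x,y]$. An (absolutely) irreducible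 plane curve $F(x,y)=0$ with $F\in\mathbb{F}_q[x,y]$ is called $q$-Frobenius nonclassical if $F$ divides $(x^q-x)\frac{\partial F}{\partial x}+(y^q-y)\frac{\partial F}{\partial y}$. *)

theory Defs
  imports "HOL-Algebra.Algebraic_Closure_Type" "HOL-Library.Cardinality" "HOL-Computational_Algebra.Computational_Algebra"
begin

section \<open>Polynomials over a finite field\<close>

definition value_set :: "'a::field poly \<Rightarrow> 'a set" where
  "value_set F = range (poly F)"

definition minimal_value_set_poly :: "'a::finite_field poly \<Rightarrow> bool" where
  "minimal_value_set_poly F \<longleftrightarrow>
     degree F > 0 \<and> card (value_set F) = (CARD('a) - 1) div degree F + 1"

text \<open>
  The division by \<open>g\<close> is exact, since \<open>g\<close> divides \<open>t\<^sup>q - t\<close>.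
  A divisor of \<open>t\<^sup>q - t\<close> is proper if it is not an associate of \<open>t\<^sup>q - t\<close>;
  for monic divisors this means that it is different from \<open>t\<^sup>q - t\<close>. The divisor \<open>1\<close> is
  admitted; it only contributes constants (\<open>0\<close> to type A, \<open>1\<close> to type B).
\<close>

definition type_A_set :: "'a::finite_field poly set" where
  "type_A_set =
     {(pderiv g * (monom 1 1 - monom 1 CARD('a))) div g | g.
        lead_coeff g = 1 \<and> g dvd (monom 1 CARD('a) - monom 1 1) \<and>
        g \<noteq> monom 1 CARD('a) - monom 1 1 \<and> pderiv (pderiv g) = 0}"

definition type_B_set :: "'a::finite_field poly set" where
  "type_B_set = {1 - f | f. f \<in> type_A_set}"

section \<open>Plane curves\<close>

text \<open>
  A polynomial in \<open>x\<close> and \<open>y\<close> is an element of \<open>K[x][y]\<close>, represented by \<^typ>\<open>'a poly poly\<close>: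
  the outer variable is \<open>y\<close> and the coefficients are polynomials in \<open>x\<close>.
\<close>

definition in_x :: "'a::comm_ring_1 poly \<Rightarrow> 'a poly poly" where
  "in_x f = [:f:]"

definition in_y :: "'a::comm_ring_1 poly \<Rightarrow> 'a poly poly" where
  "in_y g = map_poly (\<lambda>c. [:c:]) g"

definition pderiv_x :: "'a::idom poly poly \<Rightarrow> 'a poly poly" where
  "pderiv_x F = map_poly pderiv F"

definition pderiv_y :: "'a::idom poly poly \<Rightarrow> 'a poly poly" where
  "pderiv_y F = pderiv F"

text \<open>The polynomial \<open>F(x\<^sup>m, y\<^sup>m)\<close>.\<close>

definition subst_powers :: "nat \<Rightarrow> 'a::comm_ring_1 poly poly \<Rightarrow> 'a poly poly" where
  "subst_powers m F = pcompose (map_poly (\<lambda>c. pcompose c (monom 1 m)) F) (monom 1 m)"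

definition extend_scalars :: "'a::field poly poly \<Rightarrow> 'a alg_closure poly poly" where
  "extend_scalars F = map_poly (map_poly to_ac) F"

definition curve_component :: "'a::field alg_closure poly poly \<Rightarrow> 'a poly poly \<Rightarrow> bool" where
  "curve_component G F \<longleftrightarrow> irreducible G \<and> G dvd extend_scalars F"

text \<open>\<open>H\<close> is an equation with coefficients in the base field of the curve \<open>G = 0\<close>.\<close>

definition base_field_equation :: "'a::field poly poly \<Rightarrow> 'a alg_closure poly poly \<Rightarrow> bool" where
  "base_field_equation H G \<longleftrightarrow> (\<exists>c. c \<noteq> 0 \<and> smult [:c:] G = extend_scalars H)"

definition defined_over_base :: "'a::field alg_closure poly poly \<Rightarrow> bool" where
  "defined_over_base G \<longleftrightarrow> (\<exists>H. base_field_equation H G)"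

definition abs_irreducible :: "'a::field poly poly \<Rightarrow> bool" where
  "abs_irreducible F \<longleftrightarrow> irreducible (extend_scalars F)"

definition frobenius_nonclassical :: "'a::finite_field poly poly \<Rightarrow> bool" where
  "frobenius_nonclassical F \<longleftrightarrow>
     abs_irreducible F \<and>
     F dvd in_x (monom 1 CARD('a) - monom 1 1) * pderiv_x F +
           in_y (monom 1 CARD('a) - monom 1 1) * pderiv_y F"

text \<open>
  Frobenius nonclassicality is a property of an equation over the base field. It is invariant
  under multiplying the equation by a nonzero constant, so for the curve \<open>G = 0\<close> it does not
  matter which equation over the base field is chosen.
\<close>

definition frobenius_nonclassical_component :: "'a::finite_field alg_closure poly poly \<Rightarrow> bool" where
  "frobenius_nonclassical_component G \<longleftrightarrow>
     (\<exists>H. base_field_equation H G \<and> frobenius_nonclassical H)"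

end

theory Submission
  imports Defs "HOL-Number_Theory.Residues"
begin

text \<open>
  Put \<open>D = (x\<^sup>q - x) \<partial>\<^sub>x + (y\<^sup>q - y) \<partial>\<^sub>y\<close> and \<open>F = f(x) - g(y)\<close>. As \<open>D\<close> is a derivation, \<open>F\<close> divides
  \<open>D F\<close> as soon as every irreducible factor \<open>G\<close> of \<open>F\<close> divides \<open>D G\<close>; the converse holds because
  \<open>F\<close> is squarefree when \<open>f'\<close> and \<open>g'\<close> do not vanish. Since \<open>D F\<close> is a difference \<open>A(x) - B(y)\<close>,
  its divisibility by \<open>F\<close> forces \<open>A = h(f)\<close> and \<open>B = h(g)\<close> for a common \<open>h\<close>. The degree bound
  \<open>q \<le> 2 deg f\<close> and the values \<open>0, 1\<close> of \<open>f\<close> leave only \<open>h = c T (T - 1)\<close>, and differentiating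
  \<open>f (f - 1) = (t\<^sup>q - t) H\<close> gives \<open>c = 1\<close> or \<open>c = -1\<close>. Finally \<open>(t\<^sup>q - t) f' = f (f - 1)\<close>
  characterises type A: with \<open>k = (t\<^sup>q - t) / g\<close>, where \<open>g\<close> has the roots at which \<open>f\<close> is \<open>1\<close>,
  interpolation gives \<open>f = - g' k\<close>, and the two sides of the equation differ by \<open>g g'' k\<^sup>2\<close>.
  Replacing \<open>f\<close> by \<open>1 - f\<close> changes the sign of \<open>c\<close> and turns type A into type B.
\<close>

section \<open>Coefficientwise maps\<close>

lemma map_poly_additive:
  fixes \<phi> :: "'a::ab_group_add \<Rightarrow> 'b::ab_group_add"
  assumes "\<And>x y. \<phi> (x + y) = \<phi> x + \<phi> y"
  shows "map_poly \<phi> (p + q) = map_poly \<phi> p + map_poly \<phi> q"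
proof -
  have "\<phi> 0 = 0" using assms[of 0 0] by simp
  then show ?thesis by (intro poly_eqI) (simp add: coeff_map_poly assms)
qed

text \<open>
  The two uses are \<open>h = id\<close>, \<open>k = \<phi>\<close> (ring homomorphisms) and \<open>k = id\<close>
  (retractions \<open>\<phi>\<close> of \<open>h\<close> that are linear over its domain).
\<close>

lemma map_poly_semilinear:
  fixes \<phi> :: "'a::comm_ring \<Rightarrow> 'b::comm_ring" and h :: "'c::comm_ring \<Rightarrow> 'a"
    and k :: "'c \<Rightarrow> 'b"
  assumes add: "\<And>x y. \<phi> (x + y) = \<phi> x + \<phi> y"
    and lin: "\<And>a z. \<phi> (h a * z) = k a * \<phi> z"
    and "h 0 = 0" "k 0 = 0"
  shows "map_poly \<phi> (map_poly h p * Q) = map_poly k p * map_poly \<phi> Q"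
proof -
  have "\<phi> 0 = 0" using add[of 0 0] by simp
  have smult: "map_poly \<phi> (smult (h a) Q) = smult (k a) (map_poly \<phi> Q)" for a
    by (rule poly_eqI) (simp add: coeff_map_poly \<open>\<phi> 0 = 0\<close> lin)
  show ?thesis
  proof (induction p)
    case (pCons a p)
    then show ?case
      by (simp add: map_poly_pCons \<open>h 0 = 0\<close> \<open>k 0 = 0\<close> \<open>\<phi> 0 = 0\<close> map_poly_additive[OF add] smult)
  qed simp
qed

section \<open>Extension of scalars to the algebraic closure, and descent of divisibility\<close>

lemma map_poly_to_ac_add:
  "map_poly to_ac (p + q) = map_poly to_ac p + map_poly to_ac q"
  by (rule map_poly_additive) simp

lemma map_poly_to_ac_mult:
  "map_poly to_ac (p * q) = map_poly to_ac p * map_poly to_ac q"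
  using map_poly_semilinear[of to_ac "\<lambda>x. x" to_ac p q] by simp

lemma extend_scalars_add: "extend_scalars (P + Q) = extend_scalars P + extend_scalars Q"
  unfolding extend_scalars_def by (rule map_poly_additive) (rule map_poly_to_ac_add)

lemma extend_scalars_mult: "extend_scalars (P * Q) = extend_scalars P * extend_scalars Q"
  unfolding extend_scalars_def
  using map_poly_semilinear[of "map_poly to_ac" "\<lambda>x. x" "map_poly to_ac" P Q]
  by (simp add: map_poly_to_ac_add map_poly_to_ac_mult)

text \<open>The closure is a vector space over the base field and the embedding is injective and
  linear, so it has a linear left inverse.\<close>

lemma to_ac_retraction:
  obtains \<phi> :: "'a::field alg_closure \<Rightarrow> 'a"
  where "\<And>x y. \<phi> (x + y) = \<phi> x + \<phi> y" "\<And>a z. \<phi> (to_ac a * z) = a * \<phi> z"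
    "\<And>a. \<phi> (to_ac a) = a"
proof -
  interpret vector_space_pair "(*) :: 'a \<Rightarrow> 'a \<Rightarrow> 'a" "\<lambda>(a::'a) z. to_ac a * z"
    by unfold_locales (simp_all add: algebra_simps)
  have "Vector_Spaces.linear (*) (\<lambda>(a::'a) z. to_ac a * z) to_ac"
    by unfold_locales (simp_all add: algebra_simps)
  from linear_injective_left_inverse[OF this inj_to_ac]
  obtain \<phi> where \<phi>: "Vector_Spaces.linear (\<lambda>(a::'a) z. to_ac a * z) (*) \<phi>" "\<phi> \<circ> to_ac = id" by auto
  interpret \<phi>: Vector_Spaces.linear "\<lambda>(a::'a) z. to_ac a * z" "(*)" \<phi> by fact
  show thesis
    using that[of \<phi>] \<phi>.add \<phi>.scale \<phi>(2) by (metis comp_apply id_apply)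
qed

lemma extend_scalars_dvd_imp_dvd:
  assumes "extend_scalars H dvd extend_scalars P"
  shows "H dvd P"
proof -
  obtain \<phi> :: "'a alg_closure \<Rightarrow> 'a" where \<phi>:
    "\<And>x y. \<phi> (x + y) = \<phi> x + \<phi> y" "\<And>a z. \<phi> (to_ac a * z) = a * \<phi> z"
    "\<And>a. \<phi> (to_ac a) = a"
    using to_ac_retraction by blast
  have \<phi>0: "\<phi> 0 = 0" using \<phi>(1)[of 0 0] by (simp only: add_0_right add_cancel_right_right)
  let ?r = "map_poly (map_poly \<phi>)"
  \<comment> \<open>Linearity of \<open>\<phi>\<close> over the base field turns a cofactor
    \<open>Q\<close> over the closure into the cofactor \<open>?r Q\<close> over the base
    field.\<close>
  have mult: "?r (extend_scalars H * Q) = H * ?r Q" for Q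
    unfolding extend_scalars_def
    using map_poly_semilinear[of "map_poly \<phi>" "map_poly to_ac" "\<lambda>x. x" H Q]
      map_poly_semilinear[of \<phi> to_ac "\<lambda>x. x"] map_poly_additive[of \<phi>] \<phi>
    by simp
  have "?r (extend_scalars P) = P"
    by (rule poly_eqI, rule poly_eqI) (simp add: extend_scalars_def coeff_map_poly \<phi> \<phi>0)
  with assms mult show ?thesis by (metis dvd_def)
qed

section \<open>The Frobenius derivation\<close>

text \<open>The exponent is a parameter because the derivation is also applied over the infinite
  algebraic closure, where it must still be the size of the base field.\<close>

definition frob_deriv :: "nat \<Rightarrow> 'a::idom poly poly \<Rightarrow> 'a poly poly" where
  "frob_deriv q F = in_x (monom 1 q - monom 1 1) * pderiv_x F +
                    in_y (monom 1 q - monom 1 1) * pderiv_y F"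

lemma pderiv_x_add: "pderiv_x (P + Q) = pderiv_x P + pderiv_x Q"
  unfolding pderiv_x_def by (rule map_poly_additive) (rule pderiv_add)

lemma pderiv_x_pCons: "pderiv_x (pCons a P) = pCons (pderiv a) (pderiv_x P)"
  by (simp add: pderiv_x_def map_poly_pCons)

lemma pderiv_x_smult: "pderiv_x (smult a P) = smult (pderiv a) P + smult a (pderiv_x P)"
  by (rule poly_eqI) (simp add: pderiv_x_def coeff_map_poly pderiv_mult algebra_simps)

lemma pderiv_x_mult: "pderiv_x (P * Q) = P * pderiv_x Q + Q * pderiv_x P"
proof (induction P)
  case 0
  show ?case by (simp add: pderiv_x_def)
next
  case (pCons a P)
  then show ?case
    by (simp add: pderiv_x_add pderiv_x_pCons pderiv_x_smult algebra_simps)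
qed

lemma frob_deriv_mult: "frob_deriv q (P * Q) = P * frob_deriv q Q + Q * frob_deriv q P"
  by (simp add: frob_deriv_def pderiv_x_mult pderiv_y_def pderiv_mult algebra_simps)

section \<open>Compatibility of the derivation with extension of scalars\<close>

lemma map_poly_to_ac_pderiv: "map_poly to_ac (pderiv p) = pderiv (map_poly to_ac p)"
  by (rule poly_eqI) (simp add: coeff_map_poly coeff_pderiv)

lemma extend_scalars_pderiv_x: "extend_scalars (pderiv_x F) = pderiv_x (extend_scalars F)"
  by (rule poly_eqI)
    (simp add: extend_scalars_def pderiv_x_def coeff_map_poly map_poly_to_ac_pderiv)

lemma extend_scalars_pderiv_y: "extend_scalars (pderiv_y F) = pderiv_y (extend_scalars F)"
  by (rule poly_eqI, rule poly_eqI)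
    (simp add: extend_scalars_def pderiv_y_def coeff_map_poly coeff_pderiv of_nat_poly
      map_poly_to_ac_mult map_poly_pCons map_poly_to_ac_add)

lemma extend_scalars_in_x: "extend_scalars (in_x f) = in_x (map_poly to_ac f)"
  by (simp add: extend_scalars_def in_x_def map_poly_pCons)

lemma extend_scalars_in_y: "extend_scalars (in_y f) = in_y (map_poly to_ac f)"
  by (rule poly_eqI) (simp add: extend_scalars_def in_y_def coeff_map_poly map_poly_pCons)

lemma map_poly_to_ac_diff:
  "map_poly to_ac (p - q) = map_poly to_ac p - map_poly to_ac q"
  by (rule poly_eqI) (simp add: coeff_map_poly)

lemma extend_scalars_diff: "extend_scalars (P - Q) = extend_scalars P - extend_scalars Q"
  using extend_scalars_add[of "P - Q" Q] by (simp add: algebra_simps)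

lemma extend_scalars_frob_deriv:
  "extend_scalars (frob_deriv q F) = frob_deriv q (extend_scalars F)"
  by (simp add: frob_deriv_def extend_scalars_add extend_scalars_mult extend_scalars_in_x
      extend_scalars_in_y extend_scalars_pderiv_x extend_scalars_pderiv_y map_poly_to_ac_diff
      map_poly_monom)

lemma in_y_add: "in_y (a + b) = in_y a + in_y b"
  unfolding in_y_def by (rule map_poly_additive) simp

lemma in_y_diff: "in_y (a - b) = in_y a - in_y b"
  using in_y_add[of "a - b" b] by (simp add: algebra_simps)

lemma in_y_mult: "in_y (a * b) = in_y a * in_y b"
  unfolding in_y_def
  using map_poly_semilinear[of "\<lambda>c. [:c:]" "\<lambda>x. x" "\<lambda>c. [:c:]" a b] by simp

lemma pderiv_x_separated: "pderiv_x (in_x f - in_y g) = in_x (pderiv f)"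
  by (rule poly_eqI)
    (simp add: pderiv_x_def in_x_def in_y_def coeff_map_poly pderiv_diff coeff_pCons split: nat.split)

lemma pderiv_y_separated: "pderiv_y (in_x f - in_y g) = - in_y (pderiv g)"
  by (rule poly_eqI)
    (simp add: pderiv_y_def in_x_def in_y_def coeff_map_poly coeff_pderiv coeff_pCons of_nat_poly)

lemma frob_deriv_separated:
  "frob_deriv q (in_x f - in_y g) =
     in_x ((monom 1 q - monom 1 1) * pderiv f) - in_y ((monom 1 q - monom 1 1) * pderiv g)"
  unfolding frob_deriv_def pderiv_x_separated pderiv_y_separated in_y_mult
  by (simp add: in_x_def)

text \<open>Induction on the prime factorization: by the Leibniz rule, if two factors divide their
  own derivatives, so does their product.\<close>

lemma dvd_frob_deriv_of_components:
  fixes P :: "'a::field alg_closure poly poly"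
  assumes "\<And>G. irreducible G \<Longrightarrow> G dvd P \<Longrightarrow> G dvd frob_deriv q G"
  shows "P dvd frob_deriv q P"
  using assms
proof (induction P rule: prime_divisors_induct)
  case zero
  show ?case by (simp add: frob_deriv_def pderiv_x_def pderiv_y_def)
next
  case (unit x)
  then show ?case by (simp add: unit_imp_dvd)
next
  case (factor p x)
  have "irreducible p"
    using factor(1) by (auto intro: prime_elem_imp_irreducible)
  then have "p dvd frob_deriv q p" by (rule factor) simp
  moreover have "x dvd frob_deriv q x"
    by (rule factor) (auto intro: factor(3))
  ultimately show ?case
    by (simp add: frob_deriv_mult mult.commute[of x] mult_dvd_mono)
qed

text \<open>A repeated factor divides both partial derivatives, which up to sign are
  \<open>f'(x)\<close> and \<open>g'(y)\<close>. The first makes it free of \<open>y\<close>, the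
  second then makes it a unit.\<close>

lemma separated_squarefree:
  fixes f g :: "'a::field alg_closure poly"
  assumes "pderiv f \<noteq> 0" "pderiv g \<noteq> 0" "irreducible G"
  shows "\<not> G * G dvd in_x f - in_y g"
proof
  assume "G * G dvd in_x f - in_y g"
  then obtain M where M: "in_x f - in_y g = G * (G * M)"
    by (metis dvdE mult.assoc)
  have "G dvd pderiv_x (in_x f - in_y g)" "G dvd pderiv_y (in_x f - in_y g)"
    unfolding M by (simp_all add: pderiv_x_mult pderiv_y_def pderiv_mult)
  then have *: "G dvd [:pderiv f:]" "G dvd in_y (pderiv g)"
    unfolding pderiv_x_separated pderiv_y_separated by (simp_all add: in_x_def)
  have "degree G = 0"
    using dvd_imp_degree_le[OF *(1)] assms(1) by simp
  then obtain c where c: "G = [:c:]" by (metis degree_eq_zeroE)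
  obtain i where i: "coeff (pderiv g) i \<noteq> 0" using assms(2) by (meson leading_coeff_neq_0)
  have "c dvd coeff (in_y (pderiv g)) i"
    using *(2) unfolding c const_poly_dvd_iff by blast
  then have "c dvd [:coeff (pderiv g) i:]" by (simp add: in_y_def coeff_map_poly)
  then have "is_unit c" using i by (meson dvd_trans is_unit_triv dvd_field_iff is_unit_const_poly_iff)
  then have "is_unit G" by (simp add: c is_unit_const_poly_iff)
  with assms(3) show False by (auto simp: irreducible_def)
qed

section \<open>Separated polynomials\<close>

text \<open>Repeated division by \<open>g\<close>; the coefficients of \<open>P\<close> are the
  digits of \<open>B\<close> in base \<open>g\<close>.\<close>

lemma base_expansion:
  fixes g B :: "'a::field poly"
  assumes "degree g > 0"
  obtains P where "poly P g = B" "\<And>i. degree (coeff P i) < degree g"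
proof -
  have "\<exists>P. poly P g = B \<and> (\<forall>i. degree (coeff P i) < degree g)"
  proof (induction "degree B" arbitrary: B rule: less_induct)
    case less
    show ?case
    proof (cases "degree B < degree g")
      case True
      then show ?thesis
        using assms by (intro exI[of _ "[:B:]"]) (auto simp: coeff_pCons split: nat.split)
    next
      case False
      have "degree (B div g) < degree B"
        using False assms by (simp add: degree_div_less less_le_trans)
      from less[OF this] obtain P where
        P: "poly P g = B div g" "\<forall>i. degree (coeff P i) < degree g" by blast
      have "degree (B mod g) < degree g" using assms degree_mod_less'[of g B] by fastforce
      with P show ?thesis
        by (intro exI[of _ "pCons (B mod g) P"]) (auto simp: coeff_pCons split: nat.split)
    qed
  qed
  then show thesis using that by blast
qed


lemma diff_dvd_poly_diff: "x - y dvd poly P x - poly P (y :: 'a::comm_ring_1)"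
proof (induction P)
  case 0
  show ?case by simp
next
  case (pCons a P)
  have "x * poly P x - y * poly P y = (x - y) * poly P x + y * (poly P x - poly P y)"
    by (simp add: algebra_simps)
  also have "x - y dvd \<dots>" by (intro dvd_add dvd_triv_left dvd_mult[OF pCons.IH])
  finally show ?case by simp
qed

text \<open>
  Modulo \<open>f(x) - g(y)\<close> the \<open>g\<close>-adic expansion of \<open>B(y)\<close> becomes a polynomial of \<open>y\<close>-degree
  less than \<open>deg g\<close>, so it has to be equal to \<open>A(x)\<close>.
\<close>

lemma separated_dvd_imp_pcompose:
  fixes f g A B :: "'a::field poly"
  assumes f: "degree f > 0" and g: "degree g > 0"
    and dvd: "in_x f - in_y g dvd in_x A - in_y B"
  obtains h where "A = pcompose h f" "B = pcompose h g"
proof -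
  obtain P where P: "poly P g = B" "\<And>i. degree (coeff P i) < degree g"
    using base_expansion[OF g] by blast
  have in_y_0: "in_y (0::'a poly) = 0" by (simp add: in_y_def)
  \<comment> \<open>\<open>h j\<close> collects the coefficients of \<open>y^j\<close> in all
    digits. \<open>S\<close> is the expansion of \<open>B(y)\<close> with \<open>g(y)\<close>
    replaced by \<open>f(x)\<close>, so its coefficient of \<open>y^j\<close> is \<open>h j\<close>
    composed with \<open>f\<close>.\<close>
  define h where "h j = map_poly (\<lambda>b. coeff b j) P" for j
  define S where "S = poly (map_poly in_y P) (in_x f)"
  have poly_in_y: "poly (map_poly in_y Q) (in_y g) = in_y (poly Q g)" for Q
    by (induction Q) (simp_all add: map_poly_pCons in_y_0 in_y_add in_y_mult)
  have "coeff (poly (map_poly in_y Q) (in_x f)) j = pcompose (map_poly (\<lambda>b. coeff b j) Q) f" for Q j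
  proof (induction Q)
    case 0
    show ?case by simp
  next
    case (pCons a Q)
    have "coeff (in_y a) j = [:coeff a j:]" by (simp add: in_y_def coeff_map_poly)
    moreover have "coeff (in_x f * R) j = f * coeff R j" for R by (simp add: in_x_def)
    ultimately show ?case
      using pCons.IH by (simp add: map_poly_pCons pcompose_pCons in_y_0)
  qed
  then have coeff_S: "coeff S j = pcompose (h j) f" for j by (simp add: S_def h_def)
  have h_0: "h j = 0" if "j \<ge> degree g" for j
    unfolding h_def using less_le_trans[OF P(2) that]
    by (intro poly_eqI) (simp add: coeff_map_poly coeff_eq_0)
  have "in_x f - in_y g dvd S - in_y B"
    unfolding S_def P(1)[symmetric] poly_in_y[symmetric] by (rule diff_dvd_poly_diff)
  with dvd have "in_x f - in_y g dvd (in_x A - in_y B) - (S - in_y B)" by (rule dvd_diff)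
  then have dvd': "in_x f - in_y g dvd in_x A - S" by simp
  have "in_x A - S = 0"
  proof (rule ccontr)
    assume "in_x A - S \<noteq> 0"
    with dvd' have le: "degree (in_x f - in_y g) \<le> degree (in_x A - S)"
      by (rule dvd_imp_degree_le)
    have "lead_coeff g \<noteq> 0" using g by auto
    moreover have "coeff [:f:] (degree g) = 0" using g by (simp add: coeff_eq_0)
    ultimately have "coeff (in_x f - in_y g) (degree g) \<noteq> 0"
      by (simp add: in_x_def in_y_def coeff_map_poly)
    then have "degree g \<le> degree (in_x A - S)" using le le_degree order_trans by blast
    moreover have "coeff (in_x A - S) m = 0" if "m \<ge> degree g" for m
      using that g by (simp add: coeff_S h_0 in_x_def coeff_eq_0)
    ultimately show False using leading_coeff_neq_0[OF \<open>in_x A - S \<noteq> 0\<close>] by blast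
  qed
  then have A: "coeff (in_x A) j = pcompose (h j) f" for j by (simp add: coeff_S[symmetric])
  \<comment> \<open>As \<open>A(x)\<close> is free of \<open>y\<close> and \<open>f\<close> is
    nonconstant, the digits of \<open>B\<close> are constants, whence \<open>B\<close> is
    \<open>h 0\<close> composed with \<open>g\<close>.\<close>
  have "h j = 0" if "j > 0" for j
    using A[of j] that f by (simp add: in_x_def coeff_pCons pcompose_eq_0 split: nat.splits)
  then have "coeff (coeff P i) j = coeff [:coeff (h 0) i:] j" for i j
    by (cases j) (auto simp: h_def coeff_map_poly poly_eq_iff)
  then have "P = map_poly (\<lambda>c. [:c:]) (h 0)"
    by (intro poly_eqI) (simp add: coeff_map_poly)
  then have "B = pcompose (h 0) g" by (metis P(1) pcompose_altdef)
  moreover have "A = pcompose (h 0) f" using A[of 0] by (simp add: in_x_def)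
  ultimately show thesis using that by blast
qed

section \<open>Two-valued polynomials over a finite field\<close>

definition frob_poly :: "'a::finite_field poly" where
  "frob_poly = monom 1 CARD('a) - monom 1 1"

lemma card_gt_1: "CARD('a::finite_field) > 1"
proof -
  have "card {0, 1 :: 'a} \<le> CARD('a)" by (intro card_mono) auto
  then show ?thesis by simp
qed

lemma degree_frob_poly: "degree (frob_poly :: 'a::finite_field poly) = CARD('a)"
proof -
  have "degree (monom (1::'a) 1) < degree (monom (1::'a) CARD('a))"
    using card_gt_1[where 'a = 'a] by (simp add: degree_monom_eq)
  then show ?thesis
    using degree_add_eq_left[of "- monom (1::'a) 1" "monom 1 CARD('a)"]
    by (simp add: degree_monom_eq frob_poly_def)
qed

lemma poly_frob_poly [simp]: "poly frob_poly (a :: 'a::finite_field) = 0"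
  by (simp add: frob_poly_def poly_monom finite_field_power_card_eq_same)

lemma degree_pderiv_le_diff: "degree (pderiv p) \<le> degree p - 1"
  by (rule degree_le) (auto simp: coeff_pderiv coeff_eq_0)

lemma pderiv_frob_poly: "pderiv (frob_poly :: 'a::finite_field poly) = -1"
proof -
  have "of_nat CARD('a) = (0 :: 'a)" by (simp add: of_nat_eq_0_iff_char_dvd CHAR_dvd_CARD)
  then show ?thesis by (simp add: frob_poly_def pderiv_diff pderiv_monom)
qed

section \<open>Polynomials vanishing on the whole field\<close>

lemma eq_0_of_vanishing:
  fixes P :: "'a::finite_field poly"
  assumes "\<And>a. poly P a = 0" "degree P < CARD('a)"
  shows "P = 0"
  using assms by (intro poly_eqI_degree[of UNIV]) auto

lemma frob_poly_dvd_of_vanishing: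
  fixes P :: "'a::finite_field poly"
  assumes "\<And>a. poly P a = 0"
  shows "frob_poly dvd P"
proof -
  let ?X = "frob_poly :: 'a poly"
  have ne: "?X \<noteq> 0" using degree_frob_poly[where 'a = 'a] card_gt_1[where 'a = 'a] by auto
  have "poly (P mod ?X) a = 0" for a
    using arg_cong[OF div_mult_mod_eq[of P ?X], of "\<lambda>p. poly p a"] assms[of a]
    by (simp only: poly_add poly_mult poly_frob_poly) simp
  moreover have "degree (P mod ?X) < CARD('a)"
    using degree_mod_less[OF ne, of P] card_gt_1[where 'a = 'a] by (auto simp: degree_frob_poly)
  ultimately have "P mod ?X = 0" by (rule eq_0_of_vanishing)
  then show ?thesis by (simp add: dvd_eq_mod_eq_0)
qed

lemma frob_poly_eq_prod: "frob_poly = (\<Prod>a\<in>(UNIV :: 'a::finite_field set). [:-a, 1:])"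
proof (rule poly_eqI_degree_lead_coeff[where n = "CARD('a)" and A = UNIV])
  have deg: "degree (\<Prod>a\<in>(UNIV :: 'a set). [:-a, 1:]) = CARD('a)"
    by (subst degree_prod_eq_sum_degree) auto
  then show "degree (\<Prod>a\<in>(UNIV :: 'a set). [:-a, 1:]) \<le> CARD('a)" by simp
  have "lead_coeff (\<Prod>a\<in>(UNIV :: 'a set). [:-a, 1:]) = 1"
    by (simp add: lead_coeff_prod)
  then show "coeff frob_poly CARD('a) = coeff (\<Prod>a\<in>(UNIV :: 'a set). [:-a, 1:]) CARD('a)"
    using card_gt_1[where 'a = 'a] by (simp add: deg frob_poly_def)
  have "poly (\<Prod>a\<in>(UNIV :: 'a set). [:-a, 1:]) z = 0" for z
    by (simp add: poly_prod)
  then show "poly frob_poly z = poly (\<Prod>a\<in>(UNIV :: 'a set). [:-a, 1:]) z" for z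
    by simp
qed (simp_all add: degree_frob_poly)

lemma two_valued_factor:
  fixes f :: "'a::finite_field poly"
  assumes "range (poly f) \<subseteq> {0, 1}"
  obtains H where "f * (f - 1) = frob_poly * H"
proof -
  have "poly (f * (f - 1)) a = 0" for a
    using assms by (auto simp: image_subset_iff)
  then show thesis using that frob_poly_dvd_of_vanishing by (metis dvd_def)
qed

text \<open>Cancelling \<open>frob_poly\<close> gives \<open>f' = c H\<close>. Differentiating
  \<open>f (f - 1) = frob_poly * H\<close> and evaluating where \<open>H\<close> is nonzero yields
  \<open>c (2 f(a) - 1) = -1\<close>, with \<open>2 f(a) - 1\<close> equal to 1 or -1.\<close>

lemma two_valued_ode_constant:
  fixes f :: "'a::finite_field poly"
  assumes val: "range (poly f) \<subseteq> {0, 1}" and pos: "degree f > 0" and less: "degree f < CARD('a)"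
    and ode: "frob_poly * pderiv f = smult c (f * (f - 1))"
  shows "c = 1 \<or> c = -1"
proof -
  let ?X = "frob_poly :: 'a poly"
  have X: "?X \<noteq> 0" using degree_frob_poly[where 'a = 'a] card_gt_1[where 'a = 'a] by auto
  obtain H where H: "f * (f - 1) = ?X * H" using two_valued_factor[OF val] .
  have "f - 1 \<noteq> 0" using pos by auto
  moreover have "degree (f - 1) = degree f"
    using degree_add_eq_left[of "-1" f] pos by simp
  ultimately have "degree (f * (f - 1)) = 2 * degree f"
    using pos by (subst degree_mult_eq) auto
  moreover have "H \<noteq> 0" using H \<open>f - 1 \<noteq> 0\<close> pos by auto
  ultimately have "2 * degree f = CARD('a) + degree H"
    unfolding H using X by (simp add: degree_mult_eq degree_frob_poly)
  then have "degree H < CARD('a)" using less by simp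
  with \<open>H \<noteq> 0\<close> obtain a where a: "poly H a \<noteq> 0" using eq_0_of_vanishing by blast
  have "?X * pderiv f = ?X * smult c H" using ode H by simp
  then have f': "pderiv f = smult c H" using X by (simp only: mult_cancel_left) simp
  have "pderiv (f * (f - 1)) = pderiv (?X * H)" by (simp only: H)
  then have "f * pderiv f + (f - 1) * pderiv f = ?X * pderiv H - H"
    by (simp only: pderiv_mult pderiv_diff pderiv_1 pderiv_frob_poly) simp
  from arg_cong[OF this, of "\<lambda>p. poly p a"]
  have "poly f a * (c * poly H a) + (poly f a - 1) * (c * poly H a) = - poly H a"
    by (simp only: f' poly_add poly_mult poly_diff poly_smult poly_frob_poly poly_1) simp
  then have "(c * (2 * poly f a - 1)) * poly H a = - 1 * poly H a" by (simp add: algebra_simps)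
  then have "c * (2 * poly f a - 1) = -1" using a by (metis mult_right_cancel)
  moreover have "poly f a = 0 \<or> poly f a = 1" using val by auto
  ultimately show ?thesis by (auto simp: minus_equation_iff)
qed

text \<open>Differentiating \<open>frob_poly = g k\<close> gives \<open>g' k + g k' = -1\<close>,
  hence \<open>f - 1 = g k'\<close>; the last term is the defect that \<open>g'' = 0\<close>
  removes.\<close>

lemma two_valued_expansion:
  fixes g k :: "'a::finite_field poly"
  assumes X: "frob_poly = g * k" and f: "f = - (pderiv g * k)"
  shows "frob_poly * pderiv f = f * (f - 1) - g * pderiv (pderiv g) * k\<^sup>2"
proof -
  have X': "pderiv g * k = -1 - g * pderiv k"
    using arg_cong[OF X, of pderiv] by (simp add: pderiv_frob_poly pderiv_mult algebra_simps)
  have "f - 1 = g * pderiv k" by (simp add: f X')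
  then have "f * (f - 1) = - (pderiv g * k) * (g * pderiv k)" by (simp only: f)
  moreover have "pderiv f = - (pderiv g * pderiv k + k * pderiv (pderiv g))"
    by (simp add: f pderiv_minus pderiv_mult)
  ultimately show ?thesis by (simp only: X) (simp add: algebra_simps power2_eq_square)
qed

lemma type_A_imp_ode:
  assumes "f \<in> type_A_set"
  shows "frob_poly * pderiv f = f * (f - 1)"
proof -
  obtain g where g: "f = (pderiv g * (monom 1 1 - monom 1 CARD('a))) div g" "lead_coeff g = 1"
    "g dvd frob_poly" "pderiv (pderiv g) = 0"
    using assms unfolding type_A_set_def frob_poly_def by blast
  from g(3) obtain k where k: "frob_poly = g * k" by (auto simp: dvd_def)
  \<comment> \<open>Type A uses \<open>t - t^q\<close>, the negative of \<open>frob_poly\<close>,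
    hence the sign in \<open>f = - g' k\<close>.\<close>
  have "monom 1 1 - monom 1 CARD('a) = g * (- k)"
    using k unfolding frob_poly_def by (metis minus_diff_eq mult_minus_right)
  moreover have "g \<noteq> 0" using g(2) by auto
  ultimately have "f = - (pderiv g * k)"
    unfolding g(1) by (simp add: mult.left_commute[of _ g] flip: mult_minus_right)
  from two_valued_expansion[OF k this] show ?thesis by (simp add: g(4))
qed

lemma ode_imp_type_A:
  fixes f :: "'a::finite_field poly"
  assumes val: "range (poly f) \<subseteq> {0, 1}" and pos: "degree f > 0" and less: "degree f < CARD('a)"
    and ode: "frob_poly * pderiv f = f * (f - 1)"
  shows "f \<in> type_A_set"
proof -
  define S where "S = {a. poly f a = 1}"
  define g where "g = (\<Prod>a\<in>S. [:-a, 1:])"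
  define k where "k = (\<Prod>a\<in>-S. [:-a, 1:])"
  have X: "frob_poly = g * k"
    unfolding frob_poly_eq_prod g_def k_def
    by (subst prod.union_disjoint[symmetric]) (auto simp: Compl_partition)
  have monic: "lead_coeff g = 1" unfolding g_def by (simp add: lead_coeff_prod)
  have ne: "g \<noteq> 0" "k \<noteq> 0" by (auto simp: g_def k_def)
  have X': "g * pderiv k + k * pderiv g = -1"
    using arg_cong[OF X, of pderiv] by (simp add: pderiv_frob_poly pderiv_mult)
  \<comment> \<open>At roots of \<open>g\<close>, \<open>X'\<close> gives \<open>g' k = -1\<close>
    while \<open>f = 1\<close>; at roots of \<open>k\<close>, both summands vanish.\<close>
  have "poly (f + pderiv g * k) a = 0" for a
  proof (cases "a \<in> S")
    case True
    then have "poly g a = 0" by (auto simp: g_def poly_prod)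
    with arg_cong[OF X', of "\<lambda>p. poly p a"] True show ?thesis
      by (simp add: S_def mult.commute)
  next
    case False
    then have "poly k a = 0" by (auto simp: k_def poly_prod)
    moreover have "poly f a = 0" using val False by (auto simp: S_def)
    ultimately show ?thesis by simp
  qed
  moreover have "degree (pderiv g * k) < CARD('a)"
  proof (cases "pderiv g = 0")
    case False
    then have "degree g > 0" by (metis pderiv_singleton degree_eq_zeroE not_gr_zero)
    then have "degree (pderiv g) < degree g"
      using degree_pderiv_le_diff[of g] by simp
    moreover have "degree g + degree k = CARD('a)"
      using ne degree_frob_poly[where 'a = 'a] by (simp add: X degree_mult_eq)
    ultimately show ?thesis using degree_mult_le[of "pderiv g" k] by linarith
  qed simp
  then have "degree (f + pderiv g * k) < CARD('a)" using less by (intro degree_add_less)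
  ultimately have "f + pderiv g * k = 0" by (rule eq_0_of_vanishing)
  then have f: "f = - (pderiv g * k)" by (simp add: eq_neg_iff_add_eq_0)
  have "g * pderiv (pderiv g) * k\<^sup>2 = 0"
    using two_valued_expansion[OF X f] ode by simp
  then have "pderiv (pderiv g) = 0" using ne by simp
  moreover have "monom 1 1 - monom 1 CARD('a) = g * (- k)"
    using X unfolding frob_poly_def by (metis minus_diff_eq mult_minus_right)
  then have "f = (pderiv g * (monom 1 1 - monom 1 CARD('a))) div g"
    using ne by (simp add: f mult.left_commute[of _ g] flip: mult_minus_right)
  \<comment> \<open>Otherwise \<open>k = 1\<close>, and \<open>f = - g' = 1\<close> would be
    constant.\<close>
  moreover have "g \<noteq> frob_poly"
  proof
    assume "g = frob_poly"
    then have "k = 1" using X ne by simp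
    then have "f = 1" using f \<open>g = frob_poly\<close> pderiv_frob_poly[where 'a = 'a] by simp
    with pos show False by simp
  qed
  moreover have "g dvd frob_poly" unfolding X by simp
  ultimately show ?thesis unfolding type_A_set_def frob_poly_def using monic by blast
qed

lemma type_B_iff: "f \<in> type_B_set \<longleftrightarrow> 1 - f \<in> type_A_set"
  unfolding type_B_set_def by (auto intro: exI[of _ "1 - f"])

lemma type_B_imp_ode:
  assumes "f \<in> type_B_set"
  shows "frob_poly * pderiv f = - (f * (f - 1))"
  using type_A_imp_ode[of "1 - f"] assms unfolding type_B_iff
  by (simp add: pderiv_diff algebra_simps)

lemma ode_imp_type_B:
  fixes f :: "'a::finite_field poly"
  assumes val: "range (poly f) \<subseteq> {0, 1}" and pos: "degree f > 0" and less: "degree f < CARD('a)"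
    and ode: "frob_poly * pderiv f = - (f * (f - 1))"
  shows "f \<in> type_B_set"
  unfolding type_B_iff
proof (rule ode_imp_type_A)
  show "range (poly (1 - f)) \<subseteq> {0, 1}" using val by (auto simp: image_subset_iff)
  have "degree (1 - f) = degree f"
    using degree_add_eq_right[of 1 "- f"] pos by simp
  then show "degree (1 - f) > 0" "degree (1 - f) < CARD('a)" using pos less by simp_all
  show "frob_poly * pderiv (1 - f) = (1 - f) * (1 - f - 1)"
    using ode by (simp add: pderiv_diff algebra_simps)
qed

text \<open>Two values mean that the quotient of \<open>q - 1\<close> by \<open>deg f\<close> is 1,
  that is, \<open>deg f \<le> q - 1 < 2 deg f\<close>.\<close>

lemma minimal_two_valued_degree:
  fixes f :: "'a::finite_field poly"
  assumes "minimal_value_set_poly f" "value_set f = {0, 1}"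
  shows "degree f < CARD('a)" "CARD('a) \<le> 2 * degree f"
proof -
  have pos: "degree f > 0" and eq: "(CARD('a) - 1) div degree f = 1"
    using assms by (auto simp: minimal_value_set_poly_def)
  show "degree f < CARD('a)"
    using eq pos card_gt_1[where 'a = 'a] div_less[of "CARD('a) - 1" "degree f"]
    by (cases "CARD('a) - 1 < degree f") auto
  have "CARD('a) - 1 < Suc 1 * degree f"
    using eq pos by (metis div_less_iff_less_mult lessI)
  then show "CARD('a) \<le> 2 * degree f" by simp
qed

lemma vanishing_quadratic:
  fixes h :: "'a::field poly"
  assumes "degree h \<le> 2" "poly h 0 = 0" "poly h 1 = 0"
  obtains c where "h = smult c [:0, -1, 1:]"
proof -
  have "h = [:coeff h 0, coeff h 1, coeff h 2:]"
    using assms(1)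
    by (intro poly_eqI) (auto simp: coeff_pCons coeff_eq_0 numeral_2_eq_2 split: nat.split)
  moreover from this assms(2,3) have "coeff h 0 = 0" "coeff h 1 = - coeff h 2"
    by (metis poly_0_coeff_0, metis (no_types, lifting) add.commute add_cancel_right_right
        eq_neg_iff_add_eq_0 mult_1 mult_zero_right poly_0_coeff_0 poly_pCons poly_0)
  ultimately show thesis using that[of "coeff h 2"] by simp
qed

section \<open>Components\<close>

text \<open>In \<open>D(u G) = u D G + G D u\<close> the last summand is a multiple of
  \<open>G\<close>, and the unit cancels.\<close>

lemma dvd_frob_deriv_unit_mult:
  assumes "is_unit u"
  shows "u * G dvd frob_deriv q (u * G) \<longleftrightarrow> G dvd frob_deriv q G"
proof -
  have "u * G dvd frob_deriv q (u * G) \<longleftrightarrow> G dvd u * frob_deriv q G + G * frob_deriv q u"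
    using assms by (simp add: frob_deriv_mult mult_unit_dvd_iff')
  also have "\<dots> \<longleftrightarrow> G dvd frob_deriv q G"
    using assms by (simp add: dvd_add_left_iff dvd_mult_unit_iff')
  finally show ?thesis .
qed

lemma base_field_equation_frob_deriv:
  fixes H :: "'a::field poly poly"
  assumes "base_field_equation H G"
  shows "H dvd frob_deriv q H \<longleftrightarrow> G dvd frob_deriv q G"
proof -
  obtain c where c: "c \<noteq> 0" "smult [:c:] G = extend_scalars H"
    using assms by (auto simp: base_field_equation_def)
  have "is_unit [:[:c:]:]" using c(1) by (simp add: is_unit_const_poly_iff dvd_field_iff)
  from dvd_frob_deriv_unit_mult[OF this, of G q]
  have "extend_scalars H dvd frob_deriv q (extend_scalars H) \<longleftrightarrow> G dvd frob_deriv q G"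
    using c(2) by simp
  moreover have "extend_scalars H dvd frob_deriv q (extend_scalars H) \<longleftrightarrow> H dvd frob_deriv q H"
    unfolding extend_scalars_frob_deriv[symmetric]
    by (metis dvd_def extend_scalars_dvd_imp_dvd extend_scalars_mult)
  ultimately show ?thesis by simp
qed

lemma base_field_equation_irreducible:
  fixes H :: "'a::field poly poly"
  assumes "base_field_equation H G" "irreducible G"
  shows "abs_irreducible H"
proof -
  obtain c where c: "c \<noteq> 0" "smult [:c:] G = extend_scalars H"
    using assms by (auto simp: base_field_equation_def)
  have "is_unit [:[:c:]:]" using c(1) by (simp add: is_unit_const_poly_iff dvd_field_iff)
  from irreducible_mult_unit_left[OF this, of G] show ?thesis
    using c(2) assms(2) by (simp add: abs_irreducible_def)
qed

text \<open>Removes the choice of a base field equation: the condition becomes a divisibility over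
  the closure.\<close>

lemma frobenius_nonclassical_component_iff:
  fixes G :: "'a::finite_field alg_closure poly poly"
  assumes "irreducible G" "defined_over_base G"
  shows "frobenius_nonclassical_component G \<longleftrightarrow> G dvd frob_deriv CARD('a) G"
  using assms base_field_equation_frob_deriv base_field_equation_irreducible
  unfolding frobenius_nonclassical_component_def frobenius_nonclassical_def defined_over_base_def
    frob_deriv_def[symmetric]
  by blast

text \<open>With a common \<open>c\<close>, \<open>D F = c F (f + g - 1)\<close>. For
  \<open>F = G K\<close> this gives that \<open>G\<close> divides \<open>K D G\<close>, and the
  prime \<open>G\<close> does not divide \<open>K\<close>.\<close>

lemma separated_ode_imp_component_dvd:
  fixes f g :: "'a::finite_field poly"
  assumes "degree f > 0" "degree g > 0"
    and f: "frob_poly * pderiv f = smult c (f * (f - 1))"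
    and g: "frob_poly * pderiv g = smult c (g * (g - 1))"
    and "c \<noteq> 0"
    and G: "curve_component G (in_x f - in_y g)"
  shows "G dvd frob_deriv CARD('a) G"
proof -
  let ?F = "in_x f - in_y g"
  \<comment> \<open>The equations with \<open>c \<noteq> 0\<close> make both derivatives nonzero, as
    squarefreeness requires.\<close>
  have "f * (f - 1) \<noteq> 0" "g * (g - 1) \<noteq> 0" using assms(1,2) by auto
  then have "pderiv f \<noteq> 0" "pderiv g \<noteq> 0" using f g \<open>c \<noteq> 0\<close> by auto
  then have nz: "pderiv (map_poly to_ac f) \<noteq> 0" "pderiv (map_poly to_ac g) \<noteq> 0"
    by (simp_all add: map_poly_to_ac_pderiv[symmetric] map_poly_eq_0_iff)
  have irr: "irreducible G" and "G dvd extend_scalars ?F"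
    using G by (simp_all add: curve_component_def)
  then obtain K where K: "extend_scalars ?F = G * K" by (auto simp: dvd_def)
  have "\<not> G dvd K"
    using separated_squarefree[OF nz irr] K
    by (auto simp: extend_scalars_diff extend_scalars_in_x extend_scalars_in_y)
  have in_y_smult: "in_y (smult c p) = smult [:c:] (in_y p)" for p :: "'a poly"
    by (rule poly_eqI) (simp add: in_y_def coeff_map_poly)
  have in_y_1: "in_y (1 :: 'a poly) = 1" by (simp add: in_y_def)
  have in_x: "in_x (smult c (f * (f - 1))) = smult [:c:] (in_x f * (in_x f - 1))"
    by (simp add: in_x_def one_pCons mult.commute[of f])
  have "frob_deriv CARD('a) ?F = smult [:c:] (in_x f * (in_x f - 1) - in_y g * (in_y g - 1))"
    unfolding frob_deriv_separated frob_poly_def[symmetric] f g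
    by (simp only: in_x in_y_smult in_y_mult in_y_diff in_y_1 smult_diff_right)
  also have "in_x f * (in_x f - 1) - in_y g * (in_y g - 1) = ?F * (in_x f + in_y g - 1)"
    by (simp only: algebra_simps)
  finally have "frob_deriv CARD('a) ?F = smult [:c:] (?F * (in_x f + in_y g - 1))" .
  then have "?F dvd frob_deriv CARD('a) ?F" by (simp add: dvd_smult)
  then have "G * K dvd frob_deriv CARD('a) (G * K)"
    unfolding K[symmetric] extend_scalars_frob_deriv[symmetric]
    by (metis dvd_def extend_scalars_mult)
  then have "G dvd G * frob_deriv CARD('a) K + K * frob_deriv CARD('a) G"
    unfolding frob_deriv_mult using dvd_mult_left by blast
  then have "G dvd K * frob_deriv CARD('a) G" by (simp add: dvd_add_right_iff)
  with \<open>\<not> G dvd K\<close> irr show ?thesis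
    by (meson irreducible_imp_prime_elem prime_elem_dvd_mult_iff)
qed

lemma component_dvd_imp_separated_ode:
  fixes f g :: "'a::finite_field poly"
  assumes f: "minimal_value_set_poly f" "value_set f = {0, 1}"
    and g: "minimal_value_set_poly g" "value_set g = {0, 1}"
    and comp: "\<And>G. curve_component G (in_x f - in_y g) \<Longrightarrow> G dvd frob_deriv CARD('a) G"
  obtains c where "frob_poly * pderiv f = smult c (f * (f - 1))"
    "frob_poly * pderiv g = smult c (g * (g - 1))"
proof -
  let ?F = "in_x f - in_y g"
  have pos: "degree f > 0" "degree g > 0"
    using f g by (simp_all add: minimal_value_set_poly_def)
  have "extend_scalars ?F dvd frob_deriv CARD('a) (extend_scalars ?F)"
    by (rule dvd_frob_deriv_of_components) (simp add: comp curve_component_def)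
  then have "?F dvd frob_deriv CARD('a) ?F"
    unfolding extend_scalars_frob_deriv[symmetric] by (rule extend_scalars_dvd_imp_dvd)
  then obtain h where h: "frob_poly * pderiv f = pcompose h f" "frob_poly * pderiv g = pcompose h g"
    unfolding frob_deriv_separated frob_poly_def[symmetric] using separated_dvd_imp_pcompose[OF pos] by blast
  have "degree h \<le> 2"
  proof -
    \<comment> \<open>The left side is the degree of \<open>frob_poly * f'\<close>, at most
      \<open>q + deg f - 1\<close>, and \<open>q \<le> 2 deg f\<close>.\<close>
    have "degree h * degree f \<le> CARD('a) + degree (pderiv f)"
      using degree_mult_le[of "frob_poly :: 'a poly" "pderiv f"]
      by (simp add: h(1) degree_pcompose degree_frob_poly)
    also have "\<dots> < 3 * degree f"
      using minimal_two_valued_degree[OF f] degree_pderiv_le_diff[of f] pos(1) by linarith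
    finally show ?thesis using pos(1) by simp
  qed
  \<comment> \<open>Since \<open>frob_poly\<close> vanishes on the field, \<open>h\<close> vanishes
    at the values 0 and 1 of \<open>f\<close>.\<close>
  moreover have "poly h (poly f a) = 0" for a
    using arg_cong[OF h(1), of "\<lambda>p. poly p a"] by (simp add: poly_pcompose del: poly_diff)
  then have "poly h 0 = 0" "poly h 1 = 0"
    using f(2) unfolding value_set_def by (metis insertI1 insert_commute imageE)+
  ultimately obtain c where c: "h = smult c [:0, -1, 1:]" by (rule vanishing_quadratic)
  have "pcompose h p = smult c (p * (p - 1))" for p
    unfolding c pcompose_smult by (simp add: pcompose_pCons one_pCons algebra_simps)
  with h that show thesis by simp
qed

theorem theorem4p4:
  fixes f g :: "'a::finite_field poly"
    and p n q :: nat
  assumes "prime p" and "odd p" and "n > 0" and "q = p ^ n" and "CARD('a) = q"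
    and "degree f > 0" and "degree g > 0"
    and "in_x f - in_y g \<notin> range (subst_powers p)"
    and "\<And>G. curve_component G (in_x f - in_y g) \<Longrightarrow> defined_over_base G"
    and "minimal_value_set_poly f" and "minimal_value_set_poly g"
    and "value_set f = {0, 1}" and "value_set g = {0, 1}"
  shows "(\<forall>G. curve_component G (in_x f - in_y g) \<longrightarrow> frobenius_nonclassical_component G)
    \<longleftrightarrow> (f \<in> type_A_set \<and> g \<in> type_A_set) \<or> (f \<in> type_B_set \<and> g \<in> type_B_set)"
proof -
  have pos: "degree f > 0" "degree g > 0"
    and less: "degree f < CARD('a)" "degree g < CARD('a)"
    and val: "range (poly f) \<subseteq> {0, 1}" "range (poly g) \<subseteq> {0, 1}"
    using assms(6,7,10-13) minimal_two_valued_degree(1) by (simp_all add: value_set_def)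
  have "(\<forall>G. curve_component G (in_x f - in_y g) \<longrightarrow> frobenius_nonclassical_component G) \<longleftrightarrow>
    (\<forall>G. curve_component G (in_x f - in_y g) \<longrightarrow> G dvd frob_deriv CARD('a) G)"
    using assms(9) frobenius_nonclassical_component_iff by (metis curve_component_def)
  also have "\<dots> \<longleftrightarrow> (f \<in> type_A_set \<and> g \<in> type_A_set) \<or> (f \<in> type_B_set \<and> g \<in> type_B_set)"
  proof
    assume "\<forall>G. curve_component G (in_x f - in_y g) \<longrightarrow> G dvd frob_deriv CARD('a) G"
    then obtain c where c: "frob_poly * pderiv f = smult c (f * (f - 1))"
      "frob_poly * pderiv g = smult c (g * (g - 1))"
      using component_dvd_imp_separated_ode assms(10-13) by metis
    \<comment> \<open>Both equations share \<open>c\<close>, so its value, found from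
      \<open>f\<close> alone, decides the common type.\<close>
    have "c = 1 \<or> c = -1" by (rule two_valued_ode_constant[OF val(1) pos(1) less(1) c(1)])
    then show "(f \<in> type_A_set \<and> g \<in> type_A_set) \<or> (f \<in> type_B_set \<and> g \<in> type_B_set)"
    proof
      assume "c = 1"
      then show ?thesis
        using c ode_imp_type_A[OF val(1) pos(1) less(1)] ode_imp_type_A[OF val(2) pos(2) less(2)]
        by simp
    next
      assume "c = -1"
      then show ?thesis
        using c ode_imp_type_B[OF val(1) pos(1) less(1)] ode_imp_type_B[OF val(2) pos(2) less(2)]
        by simp
    qed
  next
    assume "(f \<in> type_A_set \<and> g \<in> type_A_set) \<or> (f \<in> type_B_set \<and> g \<in> type_B_set)"
    then obtain c where "c \<noteq> 0" "frob_poly * pderiv f = smult c (f * (f - 1))"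
      "frob_poly * pderiv g = smult c (g * (g - 1))"
    proof (elim disjE conjE)
      assume "f \<in> type_A_set" "g \<in> type_A_set"
      then show thesis using that[of 1] by (simp add: type_A_imp_ode)
    next
      assume "f \<in> type_B_set" "g \<in> type_B_set"
      then show thesis using that[of "-1"] by (simp add: type_B_imp_ode)
    qed
    then show "\<forall>G. curve_component G (in_x f - in_y g) \<longrightarrow> G dvd frob_deriv CARD('a) G"
      using separated_ode_imp_component_dvd pos by blast
  qed
  finally show ?thesis .
qed

end
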